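(* Let $n,m\ge1$ be integers. The optimal objective value of the following integer linear program (with $\mathcal{H}_m$, $\ell(h)$ and $\lambda_i(h)$ as defined in the context) is equal to $\mathrm{OPT}^{\mathrm{det,full}}_n(m)$, the optimal worst-case success probability of deterministic policies in the adversarial-order full-history model with $m$ signals: $$\begin{aligned}\max\quad & z\\ \text{s.t.}\quad & \sum_{t=\ell(h)}^n x_{h,t}=1 && \forall h\in\mathcal{H}_m,\\ & \sum_{h\in\mathcal{H}_m:\ \ell(h)\le i}\lambda_i(h)\,x_{h,i}\ge z && \forall i\in[n],\\ & x_{h,t}\in\{0,1\} && \forall h\in\mathcal{H}_m,\ \forall t\in\{\ell(h),\dots,n\}.\end{aligned}$$
   Context: Notation: $[n]=\{1,\dots,n\}$. Adversarial-order full-history model with $m$ signals: an adversary fixes an instance, i.e. a value vector $v\in\mathbb{N}_0^n$ with a unique maximum entry, located at a time $i^\star\in[n]$. Items arrive one by one at times $1,\dots,n$ in this order. Signal times $S_1,\dots,S_m$ are drawn independently and uniformly from $[i^\star]$. At each time $t$ the policy observes $v_t$ and the number of signals occurring at time $t$ (signals are unlabeled), and then irrevocably decides whether to stop at time $t$. It knows $n$ and $m$, but not the instance; it succeeds if it stops exactly at time $i^\star$. A deterministic policy uses no internal randomness: its decision at time $t$ is a function of the observations up to time $t$. The worst-case success probability of a policy is the infimum over all instances of length $n$ of its success probability (over the signals). $\mathrm{OPT}^{\mathrm{det,full}}_n(m)$ is the supremum of the worst-case success probability over all deterministic policies. Histories: a history is a vector $h=(c_1,\dots,c_{\ell(h)},0,\dots,0)\in\{0,1,\dots,m\}^n$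 with $c_{\ell(h)}>0$ and $\sum_{t=1}^{\ell(h)}c_t=m$; here $c_t$ is the number of signals at time $t$ and $\ell(h)\in[n]$ is the time of the last signal. $\mathcal{H}_m$ is the set of all histories. For $i\in[n]$ and $h\in\mathcal{H}_m$, with $0!=1$, $$\lambda_i(h):=\begin{cases}\dfrac{m!}{c_1!\cdots c_{\ell(h)}!}\cdot\dfrac1{i^m}, & \ell(h)\le i,\\ 0, & \ell(h)>i.\end{cases}$$ *)

theory Defs
  imports "HOL-Probability.Probability"
begin

text \<open>
  Times are \<open>1, \<dots>, n\<close>. Vectors indexed by \<open>[n]\<close> are functions that are
  extensional on \<open>{1..n}\<close>, so that each vector is represented exactly once.
\<close>

section \<open>Instances, signals and policies\<close>

definition unique_max_at :: "nat \<Rightarrow> (nat \<Rightarrow> nat) \<Rightarrow> nat \<Rightarrow> bool" where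
  "unique_max_at n v i \<longleftrightarrow> i \<in> {1..n} \<and> (\<forall>j\<in>{1..n} - {i}. v j < v i)"

definition instances :: "nat \<Rightarrow> (nat \<Rightarrow> nat) set" where
  "instances n = {v \<in> {1..n} \<rightarrow>\<^sub>E UNIV. \<exists>i. unique_max_at n v i}"

definition max_time :: "nat \<Rightarrow> (nat \<Rightarrow> nat) \<Rightarrow> nat" where
  "max_time n v = (THE i. unique_max_at n v i)"

text \<open>
  Joint law of \<open>(S\<^sub>1, \<dots>, S\<^sub>m)\<close>: independent and uniform on \<open>{1..i}\<close>.
  The second argument of \<^const>\<open>Pi_pmf\<close> is only the value outside the index set \<open>{1..m}\<close>.
\<close>

definition signals :: "nat \<Rightarrow> nat \<Rightarrow> (nat \<Rightarrow> nat) pmf" where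
  "signals m i = Pi_pmf {1..m} 0 (\<lambda>_. pmf_of_set {1..i})"

definition signal_count :: "nat \<Rightarrow> (nat \<Rightarrow> nat) \<Rightarrow> nat \<Rightarrow> nat" where
  "signal_count m S t = card {j \<in> {1..m}. S j = t}"

definition observations :: "nat \<Rightarrow> (nat \<Rightarrow> nat) \<Rightarrow> (nat \<Rightarrow> nat) \<Rightarrow> nat \<Rightarrow> (nat \<times> nat) list" where
  "observations m v S t = map (\<lambda>s. (v s, signal_count m S s)) [1..<Suc t]"

text \<open>
  A deterministic policy maps the observations up to the current time (whose number is the
  current time) to the decision whether to stop. Since \<open>n\<close> and \<open>m\<close> are fixed when the
  supremum over policies is taken, the policy may depend on both.
\<close>

type_synonym policy = "(nat \<times> nat) list \<Rightarrow> bool"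

definition stops_at :: "nat \<Rightarrow> policy \<Rightarrow> (nat \<Rightarrow> nat) \<Rightarrow> (nat \<Rightarrow> nat) \<Rightarrow> nat \<Rightarrow> bool" where
  "stops_at m p v S t \<longleftrightarrow>
     p (observations m v S t) \<and> (\<forall>s\<in>{1..<t}. \<not> p (observations m v S s))"

definition success_prob :: "nat \<Rightarrow> nat \<Rightarrow> policy \<Rightarrow> (nat \<Rightarrow> nat) \<Rightarrow> real" where
  "success_prob n m p v =
     measure_pmf.prob (signals m (max_time n v)) {S. stops_at m p v S (max_time n v)}"

text \<open>
  For \<open>n \<ge> 1\<close> the set of instances is nonempty, and all the probabilities lie in \<open>[0, 1]\<close>;
  so the real-valued infimum and supremum below are the true ones.
\<close>

definition worst_case_prob :: "nat \<Rightarrow> nat \<Rightarrow> policy \<Rightarrow> real" where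
  "worst_case_prob n m p = (INF v\<in>instances n. success_prob n m p v)"

definition OPT_det_full :: "nat \<Rightarrow> nat \<Rightarrow> real" where
  "OPT_det_full n m = (SUP p. worst_case_prob n m p)"

section \<open>The integer linear program\<close>

definition histories :: "nat \<Rightarrow> nat \<Rightarrow> (nat \<Rightarrow> nat) set" where
  "histories n m = {h \<in> {1..n} \<rightarrow>\<^sub>E {0..m}.
     \<exists>l\<in>{1..n}. h l > 0 \<and> (\<forall>t\<in>{l<..n}. h t = 0) \<and> (\<Sum>t=1..l. h t) = m}"

definition last_signal :: "nat \<Rightarrow> (nat \<Rightarrow> nat) \<Rightarrow> nat" where
  "last_signal n h = Max {t \<in> {1..n}. h t > 0}"

definition lam :: "nat \<Rightarrow> nat \<Rightarrow> nat \<Rightarrow> (nat \<Rightarrow> nat) \<Rightarrow> real" where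
  "lam n m i h =
     (if last_signal n h \<le> i
      then fact m / (\<Prod>t=1..last_signal n h. fact (h t)) * (1 / real i ^ m)
      else 0)"

text \<open>
  The program has variables \<open>x h t\<close> only for histories \<open>h\<close> and \<open>t \<in> {last_signal n h..n}\<close>;
  no constraint refers to any other value of \<open>x\<close>.
\<close>

definition ilp_feasible :: "nat \<Rightarrow> nat \<Rightarrow> ((nat \<Rightarrow> nat) \<Rightarrow> nat \<Rightarrow> real) \<Rightarrow> real \<Rightarrow> bool" where
  "ilp_feasible n m x z \<longleftrightarrow>
     (\<forall>h\<in>histories n m. (\<Sum>t=last_signal n h..n. x h t) = 1) \<and>
     (\<forall>i\<in>{1..n}. (\<Sum>h\<in>{h \<in> histories n m. last_signal n h \<le> i}. lam n m i h * x h i) \<ge> z) \<and>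
     (\<forall>h\<in>histories n m. \<forall>t\<in>{last_signal n h..n}. x h t \<in> {0, 1})"

text \<open>The optimal value of a maximisation program is an attained upper bound of its objective.\<close>

definition is_ilp_optimal_value :: "nat \<Rightarrow> nat \<Rightarrow> real \<Rightarrow> bool" where
  "is_ilp_optimal_value n m w \<longleftrightarrow>
     (\<exists>x. ilp_feasible n m x w) \<and> (\<forall>x z. ilp_feasible n m x z \<longrightarrow> z \<le> w)"

end

theory Submission
  imports Defs "HOL-Combinatorics.Multiset_Permutations"
begin

text \<open>
  On the instances \<open>(1, 2, \<dots>, i, 0, \<dots>, 0)\<close> a policy cannot tell the position of the maximum
  before it has passed, so on all of them it behaves like one stopping time on signal histories;
  that stopping time is a feasible point of the program. Conversely, a feasible point assigns one
  stopping time to every history, and a policy can follow it while ignoring the values, since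
  all signals have occurred by time \<open>i\<close>. As there are only finitely many assignments of
  stopping times to histories, the supremum over policies is attained.
\<close>

section \<open>Histories\<close>

definition history :: "nat \<Rightarrow> nat \<Rightarrow> (nat \<Rightarrow> nat) \<Rightarrow> nat \<Rightarrow> nat" where
  "history n m S = restrict (signal_count m S) {1..n}"

lemma history_apply: "t \<in> {1..n} \<Longrightarrow> history n m S t = signal_count m S t"
  by (simp add: history_def)

text \<open>Entries after the last positive one vanish, so the prefix sum up to it is the total, and
  a positive total forces a positive entry to exist. This replaces the witness \<open>l\<close> by a
  single equation.\<close>

lemma histories_iff_sum:
  assumes "m \<ge> 1"
  shows "h \<in> histories n m \<longleftrightarrow> h \<in> extensional {1..n} \<and> (\<Sum>t=1..n. h t) = m"
proof
  assume "h \<in> histories n m"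
  then obtain l where h: "h \<in> {1..n} \<rightarrow>\<^sub>E {0..m}" and l: "l \<in> {1..n}"
      "\<forall>t\<in>{l<..n}. h t = 0" "(\<Sum>t=1..l. h t) = m"
    by (auto simp: histories_def)
  have "(\<Sum>t=1..n. h t) = (\<Sum>t=1..l. h t)"
    using l by (intro sum.mono_neutral_right) auto
  with h l show "h \<in> extensional {1..n} \<and> (\<Sum>t=1..n. h t) = m"
    by (auto simp: PiE_def)
next
  assume h: "h \<in> extensional {1..n} \<and> (\<Sum>t=1..n. h t) = m"
  define P where "P = {t \<in> {1..n}. h t > 0}"
  have "finite P" by (simp add: P_def)
  have "P \<noteq> {}"
  proof
    assume "P = {}"
    then have "(\<Sum>t=1..n. h t) = 0" by (auto simp: P_def)
    with h assms show False by simp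
  qed
  define l where "l = Max P"
  have lP: "l \<in> P" using \<open>finite P\<close> \<open>P \<noteq> {}\<close> by (simp add: l_def)
  have z: "h t = 0" if "t \<in> {l<..n}" for t
  proof (rule ccontr)
    assume "h t \<noteq> 0"
    with that have "t \<in> P" by (auto simp: P_def)
    then have "t \<le> l" using \<open>finite P\<close> by (simp add: l_def)
    with that show False by simp
  qed
  have "(\<Sum>t=1..n. h t) = (\<Sum>t=1..l. h t)"
    using lP z by (intro sum.mono_neutral_right) (auto simp: P_def)
  moreover have "h t \<le> m" if "t \<in> {1..n}" for t
    using h member_le_sum[of t "{1..n}" h] that by auto
  ultimately show "h \<in> histories n m"
    using h lP z unfolding histories_def by (auto simp: P_def PiE_def intro!: bexI[of _ l])
qed

lemma finite_histories: "finite (histories n m)"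
  by (rule finite_subset[of _ "{1..n} \<rightarrow>\<^sub>E {0..m}"]) (auto simp: histories_def intro!: finite_PiE)

lemma last_signal_le_iff:
  assumes "h \<in> histories n m"
  shows "last_signal n h \<le> i \<longleftrightarrow> (\<forall>t\<in>{1..n}. h t > 0 \<longrightarrow> t \<le> i)"
proof -
  have "{t \<in> {1..n}. h t > 0} \<noteq> {}"
    using assms by (auto simp: histories_def)
  then show ?thesis
    unfolding last_signal_def by (subst Max_le_iff) auto
qed

lemma last_signal_range:
  assumes "h \<in> histories n m"
  shows "last_signal n h \<in> {1..n}"
proof -
  have "{t \<in> {1..n}. h t > 0} \<noteq> {}"
    using assms by (auto simp: histories_def)
  then have "last_signal n h \<in> {t \<in> {1..n}. h t > 0}"
    unfolding last_signal_def by (intro Max_in) auto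
  then show ?thesis by simp
qed

text \<open>For \<open>i \<ge> 1\<close> the set
  \<open>PiE_dflt {1..m} 0 (\<lambda>_. {1..i})\<close> is the support of
  \<open>signals m i\<close>: \<open>m\<close> times in \<open>{1..i}\<close>, and the fixed value
  \<open>0\<close> off the index set.\<close>

lemma signal_count_eq_0:
  assumes "S \<in> PiE_dflt {1..m} 0 (\<lambda>_. {1..i})" "t > i"
  shows "signal_count m S t = 0"
proof -
  have "{j \<in> {1..m}. S j = t} = {}"
    using assms by (force simp: PiE_dflt_def)
  then show ?thesis by (simp add: signal_count_def del: Collect_empty_eq)
qed

text \<open>Double counting: the fibres of \<open>S\<close> over \<open>{1..n}\<close> partition the
  \<open>m\<close> signals.\<close>

lemma sum_signal_count:
  assumes "S \<in> PiE_dflt {1..m} 0 (\<lambda>_. {1..i})" "i \<le> n"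
  shows "(\<Sum>t=1..n. signal_count m S t) = m"
proof -
  have "S ` {1..m} \<subseteq> {1..n}"
    using assms by (fastforce simp: PiE_dflt_def)
  then have "(\<Sum>t=1..n. card {j \<in> {1..m}. S j = t}) = (\<Sum>j\<in>{1..m}. 1)"
    using sum.group[of "{1..m}" "{1..n}" S "\<lambda>_. 1::nat"] by simp
  then show ?thesis by (simp add: signal_count_def)
qed

lemma history_in_histories:
  assumes "m \<ge> 1" "S \<in> PiE_dflt {1..m} 0 (\<lambda>_. {1..i})" "i \<le> n"
  shows "history n m S \<in> histories n m" "last_signal n (history n m S) \<le> i"
proof -
  have "(\<Sum>t=1..n. history n m S t) = (\<Sum>t=1..n. signal_count m S t)"
    by (intro sum.cong) (auto simp: history_def)
  with sum_signal_count[OF assms(2,3)] show h: "history n m S \<in> histories n m"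
    using assms by (simp add: histories_iff_sum history_def)
  show "last_signal n (history n m S) \<le> i"
    unfolding last_signal_le_iff[OF h]
    using signal_count_eq_0[OF assms(2)] by (metis history_apply leI less_irrefl)
qed

section \<open>The law of the history\<close>

text \<open>A history lists the multiplicities of the signal times and so carries the same
  information as their multiset. Counting signal vectors with a given history thus becomes counting
  arrangements of a multiset.\<close>

lemma history_eq_iff_mset:
  assumes S: "S \<in> PiE_dflt {1..m} 0 (\<lambda>_. {1..i})" and "i \<le> n" and h: "h \<in> extensional {1..n}"
    and M: "\<And>t. count M t = (if t \<in> {1..n} then h t else 0)"
  shows "history n m S = h \<longleftrightarrow> mset (map S [1..<Suc m]) = M"
proof -
  have c: "count (mset (map S [1..<Suc m])) t = signal_count m S t" for t
  proof -
    have "mset (map S [1..<Suc m]) = image_mset S (mset_set {1..m})"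
      by (simp only: mset_map mset_upt atLeastLessThanSuc_atLeastAtMost)
    also have "count \<dots> t = (\<Sum>j | j \<in> {1..m} \<and> t = S j. 1)"
      by (simp add: count_image_mset')
    also have "\<dots> = signal_count m S t"
      by (simp add: signal_count_def eq_commute[of t])
    finally show ?thesis .
  qed
  have z: "signal_count m S t = 0" if "t \<notin> {1..n}" for t
  proof (cases "t > i")
    case True
    then show ?thesis using S signal_count_eq_0 by blast
  next
    case False
    \<comment> \<open>Time \<open>0\<close> is the default value outside \<open>{1..m}\<close>,
      where no signal is counted; the counted values are at least \<open>1\<close>.\<close>
    with that \<open>i \<le> n\<close> have "t = 0" by auto
    then show ?thesis using S by (fastforce simp: signal_count_def PiE_dflt_def)
  qed
  have "history n m S = h \<longleftrightarrow> (\<forall>t\<in>{1..n}. signal_count m S t = h t)"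
    using h by (auto simp: history_def fun_eq_iff restrict_def extensional_def)
  also have "\<dots> \<longleftrightarrow> mset (map S [1..<Suc m]) = M"
    unfolding multiset_eq_iff c M using z by auto
  finally show ?thesis .
qed

text \<open>Fixing the value \<open>0\<close> off \<open>{1..m}\<close> makes a signal vector
  determined by its list of values. Signals are numbered from 1 and list positions from 0, hence
  \<open>j - 1\<close>.\<close>

lemma bij_betw_map_upt:
  "bij_betw (\<lambda>S. map S [1..<Suc m]) (PiE_dflt {1..m} 0 (\<lambda>_. A)) {xs. length xs = m \<and> set xs \<subseteq> A}"
proof (rule bij_betw_byWitness[where f' = "\<lambda>xs j. if j \<in> {1..m} then xs ! (j - 1) else 0"])
  show "\<forall>S\<in>PiE_dflt {1..m} 0 (\<lambda>_. A). 
      (\<lambda>j. if j \<in> {1..m} then map S [1..<Suc m] ! (j - 1) else 0) = S"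
    by (auto simp: PiE_dflt_def fun_eq_iff simp del: upt_Suc)
  show "\<forall>xs\<in>{xs. length xs = m \<and> set xs \<subseteq> A}.
      map (\<lambda>j. if j \<in> {1..m} then xs ! (j - 1) else 0) [1..<Suc m] = xs"
    by (auto intro!: nth_equalityI simp del: upt_Suc)
  show "(\<lambda>S. map S [1..<Suc m]) ` PiE_dflt {1..m} 0 (\<lambda>_. A) \<subseteq> {xs. length xs = m \<and> set xs \<subseteq> A}"
    by (auto simp: PiE_dflt_def simp del: upt_Suc)
  show "(\<lambda>xs j. if j \<in> {1..m} then xs ! (j - 1) else 0) ` {xs. length xs = m \<and> set xs \<subseteq> A}
      \<subseteq> PiE_dflt {1..m} 0 (\<lambda>_. A)"
    by (auto simp: PiE_dflt_def)
qed

text \<open>The signal vectors with history \<open>h\<close> correspond to the arrangements of the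
  multiset with \<open>h t\<close> copies of each time \<open>t\<close>; their number is a
  multinomial coefficient.\<close>

lemma card_history_eq:
  assumes "m \<ge> 1" "i \<in> {1..n}" and h: "h \<in> histories n m" and l: "last_signal n h \<le> i"
  shows "real (card {S \<in> PiE_dflt {1..m} 0 (\<lambda>_. {1..i}). history n m S = h}) =
    fact m / (\<Prod>t=1..last_signal n h. fact (h t))"
proof -
  let ?F = "PiE_dflt {1..m} 0 (\<lambda>_. {1..i})"
  let ?f = "\<lambda>S. map S [1..<Suc m]"
  define M where "M = (\<Sum>t\<in>{1..n}. replicate_mset (h t) t)"
  have ext: "h \<in> extensional {1..n}" and sum: "(\<Sum>t=1..n. h t) = m"
    using h \<open>m \<ge> 1\<close> by (auto simp: histories_iff_sum)
  have M: "count M t = (if t \<in> {1..n} then h t else 0)" for t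
    by (auto simp: M_def count_sum)
  have in_M: "t \<in># M \<longleftrightarrow> t \<in> {1..n} \<and> h t > 0" for t
    by (auto simp: M simp flip: count_greater_zero_iff)
  have size: "size M = m"
    using sum by (simp add: M_def)
  have hz: "h t = 0" if "t \<in> {1..n}" "t > last_signal n h" for t
    using last_signal_le_iff[OF h, of "last_signal n h"] that by (metis gr0I leD order_refl)
  \<comment> \<open>As \<open>M\<close> has no time beyond \<open>i\<close>, every arrangement of
    \<open>M\<close> lies in the range of the bijection \<open>?f\<close>.\<close>
  have setM: "set_mset M \<subseteq> {1..i}"
  proof
    fix t assume "t \<in># M"
    then have "t \<in> {1..n}" "h t > 0"
      by (simp_all add: in_M)
    then show "t \<in> {1..i}" using l last_signal_le_iff[OF h, of i] by auto
  qed
  have eq: "{S \<in> ?F. history n m S = h} = {S \<in> ?F. mset (?f S) = M}"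
    using history_eq_iff_mset[OF _ _ ext M] assms(2) by (intro Collect_cong conj_cong refl) simp_all
  have "bij_betw ?f {S \<in> ?F. mset (?f S) = M} (permutations_of_multiset M)"
  proof -
    have b: "bij_betw ?f ?F {xs. length xs = m \<and> set xs \<subseteq> {1..i}}"
      by (rule bij_betw_map_upt)
    have "?f ` {S \<in> ?F. mset (?f S) = M} = {xs \<in> ?f ` ?F. mset xs = M}" by blast
    also have "\<dots> = permutations_of_multiset M"
      using b size setM by (auto simp: bij_betw_def permutations_of_multiset_def)
    finally show ?thesis
      using b by (auto simp: bij_betw_def elim: inj_on_subset)
  qed
  then have card: "card {S \<in> ?F. history n m S = h} = card (permutations_of_multiset M)"
    unfolding eq by (rule bij_betw_same_card)
  \<comment> \<open>Times without a signal contribute \<open>0! = 1\<close>, so the product over the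
    support of \<open>M\<close> extends to all times up to the last signal.\<close>
  have "(\<Prod>t\<in>set_mset M. fact (count M t)) = (\<Prod>t=1..last_signal n h. fact (h t) :: nat)"
  proof (rule prod.mono_neutral_cong_left)
    show "set_mset M \<subseteq> {1..last_signal n h}"
    proof
      fix t assume "t \<in># M"
      then have "t \<in> {1..n}" "h t > 0"
        by (simp_all add: in_M)
      then show "t \<in> {1..last_signal n h}" using hz[of t] by (auto intro: leI)
    qed
    show "\<forall>t\<in>{1..last_signal n h} - set_mset M. fact (h t) = (1::nat)"
      using last_signal_range[OF h] by (auto simp: in_M)
  next
    fix t assume "t \<in># M"
    then show "fact (count M t) = (fact (h t) :: nat)"
      by (simp add: M in_M)
  qed simp
  then have "card (permutations_of_multiset M) * (\<Prod>t=1..last_signal n h. fact (h t)) = fact m"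
    using card_permutations_of_multiset_aux[of M] size by simp
  then have "real (card (permutations_of_multiset M) * (\<Prod>t=1..last_signal n h. fact (h t))) = real (fact m)"
    by (simp only:)
  then have "real (card (permutations_of_multiset M)) * (\<Prod>t=1..last_signal n h. fact (h t)) = fact m"
    by (simp only: of_nat_fact of_nat_mult of_nat_prod)
  then show ?thesis
    unfolding card by (simp add: field_simps)
qed

lemma lam_nonneg: "lam n m i h \<ge> 0"
  by (auto simp: lam_def intro!: divide_nonneg_nonneg mult_nonneg_nonneg prod_nonneg)

text \<open>The law is uniform on \<open>i ^ m\<close> vectors. Splitting the event by history gives
  fibres whose sizes, divided by \<open>i ^ m\<close>, are the weights \<open>lam n m i h\<close>.
  Both directions of the theorem use this formula.\<close>

lemma prob_history:
  assumes "m \<ge> 1" "i \<in> {1..n}"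
  shows "measure_pmf.prob (signals m i) {S. Q (history n m S)} =
    (\<Sum>h\<in>{h \<in> histories n m. last_signal n h \<le> i}. lam n m i h * of_bool (Q h))"
proof -
  let ?F = "PiE_dflt {1..m} 0 (\<lambda>_. {1..i})" and ?H = "{h \<in> histories n m. last_signal n h \<le> i}"
  have F: "finite ?F" "?F \<noteq> {}" "card ?F = i ^ m"
    using assms by (auto simp: card_PiE_dflt intro!: finite_PiE_dflt)
  have signals: "signals m i = pmf_of_set ?F"
    unfolding signals_def using assms by (intro Pi_pmf_of_set) auto
  have "?F \<inter> {S. Q (history n m S)} = (\<Union>h\<in>{h \<in> ?H. Q h}. {S \<in> ?F. history n m S = h})"
    using history_in_histories assms by fastforce
  then have card: "card (?F \<inter> {S. Q (history n m S)}) =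
      (\<Sum>h\<in>{h \<in> ?H. Q h}. card {S \<in> ?F. history n m S = h})"
    using F(1) finite_histories[of n m] by (simp only:, subst card_UN_disjoint) auto
  have "measure_pmf.prob (signals m i) {S. Q (history n m S)} =
      real (\<Sum>h\<in>{h \<in> ?H. Q h}. card {S \<in> ?F. history n m S = h}) / real (i ^ m)"
    unfolding signals measure_pmf_of_set[OF F(2,1)] F(3) card ..
  also have "\<dots> = (\<Sum>h\<in>{h \<in> ?H. Q h}. lam n m i h)"
    unfolding of_nat_sum sum_divide_distrib
    by (intro sum.cong refl, subst card_history_eq) (use assms in \<open>auto simp: lam_def\<close>)
  also have "\<dots> = (\<Sum>h\<in>?H. if Q h then lam n m i h else 0)"
    by (rule sum.inter_filter) (simp add: finite_histories)
  also have "\<dots> = (\<Sum>h\<in>?H. lam n m i h * of_bool (Q h))"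
    by (intro sum.cong refl) simp
  finally show ?thesis .
qed

section \<open>Policies and stopping times\<close>

lemma max_time_eq: "unique_max_at n v i \<Longrightarrow> max_time n v = i"
  unfolding max_time_def
  by (rule the_equality, assumption) (metis DiffI empty_iff insert_iff less_asym unique_max_at_def)

definition increasing_upto :: "nat \<Rightarrow> nat \<Rightarrow> nat \<Rightarrow> nat" where
  "increasing_upto n i = (\<lambda>t\<in>{1..n}. if t \<le> i then t else 0)"

lemma unique_max_increasing_upto:
  "i \<in> {1..n} \<Longrightarrow> unique_max_at n (increasing_upto n i) i"
  by (auto simp: unique_max_at_def increasing_upto_def)

lemma increasing_upto_instance:
  "i \<in> {1..n} \<Longrightarrow> increasing_upto n i \<in> instances n"
  unfolding instances_def using unique_max_increasing_upto[of i n]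
  by (auto simp: increasing_upto_def)

lemma worst_case_prob_le:
  "v \<in> instances n \<Longrightarrow> worst_case_prob n m p \<le> success_prob n m p v"
  unfolding worst_case_prob_def
  by (rule cINF_lower) (auto intro!: bdd_belowI[of _ 0] simp: success_prob_def)

lemma worst_case_prob_le_OPT:
  assumes "n \<ge> 1"
  shows "worst_case_prob n m p \<le> OPT_det_full n m"
  unfolding OPT_det_full_def
proof (rule cSUP_upper)
  \<comment> \<open>The real supremum needs an upper bound: the instance with its maximum at time 1
    bounds each infimum by a probability.\<close>
  have "worst_case_prob n m q \<le> 1" for q
    using worst_case_prob_le[OF increasing_upto_instance[of 1 n], of m q] assms
    by (force simp: success_prob_def intro: order_trans)
  then show "bdd_above (range (worst_case_prob n m))"
    by (auto intro!: bdd_aboveI[of _ 1])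
qed simp

text \<open>The left side of the \<open>i\<close>-th constraint at the 0/1 point encoding
  \<open>\<tau>\<close>. By \<open>prob_history\<close> it is also the probability that
  \<open>\<tau>\<close> sends the random history to \<open>i\<close> when the signals are uniform on
  \<open>{1..i}\<close>.\<close>

definition stopping_value :: "nat \<Rightarrow> nat \<Rightarrow> ((nat \<Rightarrow> nat) \<Rightarrow> nat) \<Rightarrow> nat \<Rightarrow> real" where
  "stopping_value n m \<tau> i =
    (\<Sum>h\<in>{h \<in> histories n m. last_signal n h \<le> i}. lam n m i h * of_bool (\<tau> h = i))"

text \<open>Extensionality makes this set finite, which later yields a maximiser.\<close>

definition stopping_times :: "nat \<Rightarrow> nat \<Rightarrow> ((nat \<Rightarrow> nat) \<Rightarrow> nat) set" where
  "stopping_times n m = (\<Pi>\<^sub>E h\<in>histories n m. {last_signal n h..n})"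

lemma ilp_feasible_stopping_time:
  assumes "\<tau> \<in> stopping_times n m" and "\<And>i. i \<in> {1..n} \<Longrightarrow> z \<le> stopping_value n m \<tau> i"
  shows "ilp_feasible n m (\<lambda>h t. of_bool (\<tau> h = t)) z"
  using assms by (fastforce simp: ilp_feasible_def stopping_value_def stopping_times_def of_bool_def)

text \<open>Entries in \<open>{0, 1}\<close> with sum 1 contain exactly one 1; its position is the
  stopping time of \<open>h\<close>.\<close>

lemma stopping_time_of_ilp_feasible:
  assumes "ilp_feasible n m x z"
  obtains \<tau> where "\<And>i. i \<in> {1..n} \<Longrightarrow> z \<le> stopping_value n m \<tau> i"
proof -
  have "\<exists>t\<in>{last_signal n h..n}. \<forall>s\<in>{last_signal n h..n}. x h s = of_bool (t = s)"
    if h: "h \<in> histories n m" for h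
  proof -
    let ?I = "{last_signal n h..n}"
    have s: "(\<Sum>t\<in>?I. x h t) = 1" and b: "\<forall>t\<in>?I. x h t \<in> {0, 1}"
      using assms h by (auto simp: ilp_feasible_def)
    obtain t where t: "t \<in> ?I" "x h t \<noteq> 0"
      using s by (metis sum.neutral zero_neq_one)
    have "x h t = 1" using b t by auto
    then have "(\<Sum>s\<in>?I - {t}. x h s) = 0"
      using s t by (simp add: sum_diff1)
    then have "\<forall>s\<in>?I - {t}. x h s = 0"
      using b by (subst (asm) sum_nonneg_eq_0_iff) (auto, metis atLeastAtMost_iff zero_le_one order_refl)
    with t \<open>x h t = 1\<close> show ?thesis by (intro bexI[of _ t]) auto
  qed
  then obtain \<tau> where \<tau>: "\<And>h s. h \<in> histories n m \<Longrightarrow> s \<in> {last_signal n h..n} \<Longrightarrow>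
      x h s = of_bool (\<tau> h = s)"
    by metis
  have "z \<le> stopping_value n m \<tau> i" if i: "i \<in> {1..n}" for i
  proof -
    have "z \<le> (\<Sum>h\<in>{h \<in> histories n m. last_signal n h \<le> i}. lam n m i h * x h i)"
      using assms i by (auto simp: ilp_feasible_def)
    also have "\<dots> = stopping_value n m \<tau> i"
      \<comment> \<open>On the summation set \<open>last_signal n h \<le> i \<le> n\<close>, so
        \<open>x h i\<close> is a genuine variable of the program.\<close>
      unfolding stopping_value_def using i by (intro sum.cong) (auto simp: \<tau>)
    finally show ?thesis .
  qed
  then show ?thesis using that by blast
qed

text \<open>The counts seen so far are padded with zeros. For \<open>m \<ge> 1\<close> the padded
  vector is a history only once all \<open>m\<close> signals have occurred, so the policy waits
  until it knows the full history and compares its stopping time with the current time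
  \<open>length obs\<close>. List positions start at 0, hence \<open>s - 1\<close>.\<close>

definition policy_of :: "nat \<Rightarrow> nat \<Rightarrow> ((nat \<Rightarrow> nat) \<Rightarrow> nat) \<Rightarrow> policy" where
  "policy_of n m \<tau> obs =
    (let h = (\<lambda>s\<in>{1..n}. if s \<le> length obs then snd (obs ! (s - 1)) else 0)
     in h \<in> histories n m \<and> \<tau> h = length obs)"

lemma policy_of_observations:
  "policy_of n m \<tau> (observations m v S t) \<longleftrightarrow>
    (let h = (\<lambda>s\<in>{1..n}. if s \<le> t then signal_count m S s else 0)
     in h \<in> histories n m \<and> \<tau> h = t)"
proof -
  have l: "length (observations m v S t) = t"
    by (simp add: observations_def)
  have "(\<lambda>s\<in>{1..n}. if s \<le> length (observations m v S t)
      then snd (observations m v S t ! (s - 1)) else 0) =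
    (\<lambda>s\<in>{1..n}. if s \<le> t then signal_count m S s else 0)"
    by (auto simp: observations_def simp del: upt_Suc intro!: restrict_ext)
  then show ?thesis
    unfolding policy_of_def l by simp
qed

text \<open>A stop requires the padded counts to form a history, which is then the complete one, so
  it can happen only at time \<open>\<tau> (history n m S)\<close>. At time \<open>i\<close> no
  signal is outstanding, so the padded counts are complete.\<close>

lemma stops_at_policy_of:
  assumes m: "m \<ge> 1" and i: "i \<in> {1..n}" and S: "S \<in> PiE_dflt {1..m} 0 (\<lambda>_. {1..i})"
  shows "stops_at m (policy_of n m \<tau>) v S i \<longleftrightarrow> \<tau> (history n m S) = i"
proof -
  let ?h = "\<lambda>t. \<lambda>s\<in>{1..n}. if s \<le> t then signal_count m S s else 0"
  have hist: "history n m S \<in> histories n m"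
    using history_in_histories[OF m S] i by simp
  text \<open>A truncated history still has total \<open>m\<close> only if no signal was cut off.\<close>
  have eq: "?h t = history n m S" if "?h t \<in> histories n m" for t
  proof (rule ccontr)
    assume "?h t \<noteq> history n m S"
    then obtain s where s: "s \<in> {1..n}" "?h t s \<noteq> history n m S s"
      by (auto simp: history_def fun_eq_iff split: if_splits)
    then have "?h t s < history n m S s"
      by (auto simp: history_def split: if_splits)
    with s(1) have "\<exists>s\<in>{1..n}. ?h t s < history n m S s" by blast
    moreover have "\<forall>s\<in>{1..n}. ?h t s \<le> history n m S s"
      by (simp add: history_def)
    ultimately have "(\<Sum>s=1..n. ?h t s) < (\<Sum>s=1..n. history n m S s)"
      by (intro sum_strict_mono_ex1) simp
    then show False
      using that hist by (simp add: histories_iff_sum[OF m])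
  qed
  have "?h i = history n m S"
    using signal_count_eq_0[OF S] by (auto simp: history_def fun_eq_iff restrict_def)
  then show ?thesis
    unfolding stops_at_def policy_of_observations Let_def using eq hist by auto
qed

lemma success_prob_policy_of:
  assumes "m \<ge> 1" and i: "unique_max_at n v i"
  shows "success_prob n m (policy_of n m \<tau>) v = stopping_value n m \<tau> i"
proof -
  have i': "i \<in> {1..n}" using i by (simp add: unique_max_at_def)
  \<comment> \<open>\<open>stops_at_policy_of\<close> concerns signal vectors with values in
    \<open>{1..i}\<close>; these carry all the mass, so the two events are compared almost
    everywhere.\<close>
  have "set_pmf (signals m i) \<subseteq> PiE_dflt {1..m} 0 (\<lambda>_. {1..i})"
    unfolding signals_def using i' set_Pi_pmf_subset'[of "{1..m}" 0 "\<lambda>_. pmf_of_set {1..i}"]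
    by (simp add: o_def)
  then have "success_prob n m (policy_of n m \<tau>) v =
      measure_pmf.prob (signals m i) {S. \<tau> (history n m S) = i}"
    unfolding success_prob_def max_time_eq[OF i]
    using stops_at_policy_of[OF assms(1) i']
    by (intro measure_pmf.finite_measure_eq_AE) (auto simp: AE_measure_pmf_iff)
  also have "\<dots> = stopping_value n m \<tau> i"
    unfolding stopping_value_def by (rule prob_history[OF assms(1) i'])
  finally show ?thesis .
qed

text \<open>On an instance with maximum at \<open>i\<close>, \<open>policy_of n m \<tau>\<close>
  succeeds with probability \<open>stopping_value n m \<tau> i\<close>, so a bound for all
  \<open>i\<close> bounds its worst case.\<close>

lemma stopping_value_le_OPT:
  assumes "n \<ge> 1" "m \<ge> 1" and z: "\<And>i. i \<in> {1..n} \<Longrightarrow> z \<le> stopping_value n m \<tau> i"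
  shows "z \<le> OPT_det_full n m"
proof -
  have "z \<le> worst_case_prob n m (policy_of n m \<tau>)"
    unfolding worst_case_prob_def
  proof (rule cINF_greatest)
    show "instances n \<noteq> {}"
      using increasing_upto_instance[of 1 n] assms by auto
    fix v assume "v \<in> instances n"
    then obtain i where "unique_max_at n v i" by (auto simp: instances_def)
    then show "z \<le> success_prob n m (policy_of n m \<tau>) v"
      using z[of i] success_prob_policy_of[OF assms(2)] by (simp add: unique_max_at_def)
  qed
  also have "\<dots> \<le> OPT_det_full n m"
    by (rule worst_case_prob_le_OPT[OF assms(1)])
  finally show ?thesis .
qed

text \<open>The first stop of \<open>p\<close> when the values shown are
  \<open>1, 2, 3, ...\<close>. No position of the maximum enters, so one rule serves all instances
  \<open>increasing_upto n i\<close> at once.\<close>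

definition stops_increasing :: "policy \<Rightarrow> (nat \<Rightarrow> nat) \<Rightarrow> nat \<Rightarrow> bool" where
  "stops_increasing p h t \<longleftrightarrow>
    p (map (\<lambda>s. (s, h s)) [1..<Suc t]) \<and> (\<forall>s\<in>{1..<t}. \<not> p (map (\<lambda>s. (s, h s)) [1..<Suc s]))"

lemma stops_increasing_unique:
  "stops_increasing p h s \<Longrightarrow> stops_increasing p h t \<Longrightarrow> s \<ge> 1 \<Longrightarrow> t \<ge> 1 \<Longrightarrow> s = t"
  unfolding stops_increasing_def by (metis atLeastLessThan_iff linorder_neqE_nat)

text \<open>Success at \<open>i\<close> depends only on times up to \<open>i\<close>, where the
  instance shows \<open>1, ..., i\<close>; its zeros come later.\<close>

lemma stops_at_increasing_upto:
  assumes "i \<in> {1..n}"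
  shows "stops_at m p (increasing_upto n i) S i \<longleftrightarrow> stops_increasing p (history n m S) i"
proof -
  have "observations m (increasing_upto n i) S t = map (\<lambda>s. (s, history n m S s)) [1..<Suc t]"
    if "t \<le> i" for t
    unfolding observations_def using assms that
    by (auto simp: history_def increasing_upto_def simp del: upt_Suc)
  then show ?thesis
    by (auto simp: stops_at_def stops_increasing_def simp del: upt_Suc)
qed

text \<open>For each history \<open>h\<close> take the stop of \<open>p\<close> on increasing values
  if it lies in \<open>{last_signal n h..n}\<close>, and any time in that range otherwise. No
  success is lost, since at position \<open>i\<close> only histories with
  \<open>last_signal n h \<le> i\<close> have weight.\<close>

lemma stopping_time_of_policy:
  assumes "m \<ge> 1"
  obtains \<tau> where "\<tau> \<in> stopping_times n m"
    and "\<And>i. i \<in> {1..n} \<Longrightarrow> worst_case_prob n m p \<le> stopping_value n m \<tau> i"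
proof -
  have "\<exists>t\<in>{last_signal n h..n}. \<forall>s\<in>{last_signal n h..n}. stops_increasing p h s \<longrightarrow> t = s"
    if "h \<in> histories n m" for h
    using last_signal_range[OF that] stops_increasing_unique[of p h]
    by (smt (verit) atLeastAtMost_iff order_refl order_trans)
  then obtain \<tau>' where \<tau>': "\<And>h. h \<in> histories n m \<Longrightarrow> \<tau>' h \<in> {last_signal n h..n}"
    "\<And>h s. h \<in> histories n m \<Longrightarrow> s \<in> {last_signal n h..n} \<Longrightarrow> stops_increasing p h s \<Longrightarrow> \<tau>' h = s"
    by metis
  define \<tau> where "\<tau> = restrict \<tau>' (histories n m)"
  have "worst_case_prob n m p \<le> stopping_value n m \<tau> i" if i: "i \<in> {1..n}" for i
  proof -
    have "worst_case_prob n m p \<le> success_prob n m p (increasing_upto n i)"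
      by (rule worst_case_prob_le[OF increasing_upto_instance[OF i]])
    also have "\<dots> = (\<Sum>h\<in>{h \<in> histories n m. last_signal n h \<le> i}.
        lam n m i h * of_bool (stops_increasing p h i))"
      unfolding success_prob_def max_time_eq[OF unique_max_increasing_upto[OF i]]
        stops_at_increasing_upto[OF i]
      by (rule prob_history[OF assms i])
    \<comment> \<open>A stop of \<open>p\<close> at \<open>i\<close> forces
      \<open>\<tau> h = i\<close>; the arbitrary choices of \<open>\<tau>\<close> can only add
      nonnegative terms.\<close>
    also have "\<dots> \<le> stopping_value n m \<tau> i"
      unfolding stopping_value_def
      using i \<tau>'(2) by (intro sum_mono mult_left_mono lam_nonneg) (auto simp: \<tau>_def)
    finally show ?thesis .
  qed
  moreover have "\<tau> \<in> stopping_times n m"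
    using \<tau>'(1) by (auto simp: \<tau>_def stopping_times_def)
  ultimately show ?thesis using that by blast
qed

text \<open>Each policy is dominated by one of finitely many stopping times, so the best of these,
  judged by its minimum \<open>V\<close> over all positions, dominates the supremum over
  policies.\<close>

lemma OPT_le_stopping_value:
  assumes "n \<ge> 1" "m \<ge> 1"
  obtains \<tau> where "\<tau> \<in> stopping_times n m"
    and "\<And>i. i \<in> {1..n} \<Longrightarrow> OPT_det_full n m \<le> stopping_value n m \<tau> i"
proof -
  define V where "V \<tau> = (MIN i\<in>{1..n}. stopping_value n m \<tau> i)" for \<tau>
  have V: "z \<le> V \<tau> \<longleftrightarrow> (\<forall>i\<in>{1..n}. z \<le> stopping_value n m \<tau> i)" for z \<tau>
    unfolding V_def using assms(1) by (subst Min_ge_iff) auto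
  have fin: "finite (stopping_times n m)"
    unfolding stopping_times_def using finite_histories by (intro finite_PiE) auto
  have ne: "stopping_times n m \<noteq> {}"
    using stopping_time_of_policy[OF assms(2)] by blast
  obtain \<tau> where \<tau>: "\<tau> \<in> stopping_times n m" "\<And>\<sigma>. \<sigma> \<in> stopping_times n m \<Longrightarrow> V \<sigma> \<le> V \<tau>"
    using obtains_MAX[OF fin ne, of V] Max_ge[OF finite_imageI[OF fin], of _ V] by (metis imageI)
  have "OPT_det_full n m \<le> V \<tau>"
    unfolding OPT_det_full_def
  proof (rule cSUP_least)
    fix p
    obtain \<sigma> where "\<sigma> \<in> stopping_times n m" "worst_case_prob n m p \<le> V \<sigma>"
      using stopping_time_of_policy[OF assms(2), of n p] V by metis
    then show "worst_case_prob n m p \<le> V \<tau>" using \<tau>(2) by force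
  qed simp
  then show ?thesis using that \<tau>(1) V by blast
qed

theorem theorem9:
  fixes n m :: nat
  assumes "n \<ge> 1" and "m \<ge> 1"
  shows "is_ilp_optimal_value n m (OPT_det_full n m)"
  unfolding is_ilp_optimal_value_def
proof (intro conjI allI impI)
  show "\<exists>x. ilp_feasible n m x (OPT_det_full n m)"
    using OPT_le_stopping_value[OF assms] ilp_feasible_stopping_time by metis
next
  fix x z
  assume "ilp_feasible n m x z"
  then show "z \<le> OPT_det_full n m"
    using stopping_time_of_ilp_feasible stopping_value_le_OPT[OF assms] by metis
qed

end
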